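(* Let $\mathcal C$ be an optimal quaternary $[n,k,d]$ $(r,\delta)$-LRC code with $r=3$, $\delta=3$, $d=10$ and $k=3s+1$ for some integer $s\ge2$. Then there is an integer $l$ with $4\le l\le 9$ such that $n=5l$ and $k=3l-5$.
   Context: Quaternary means over $\mathbb{F}_4$. For a linear code $\mathcal C\subseteq\mathbb{F}_q^n$ and $R\subseteq[n]=\{1,\dots,n\}$, $\mathcal C|_R$ is the code obtained by puncturing (deleting) the coordinates outside $R$. An $[n,k,d]$ linear code $\mathcal C$ is an $(r,\delta)$-LRC code if for every $i\in[n]$ there is $R_i\subseteq[n]$ with $i\in R_i$, $|R_i|\le r+\delta-1$, such that $\mathcal C|_{R_i}$ has minimum distance at least $\delta$ (every nonzero word has weight at least $\delta$). Every such code satisfies $d\le n-k+1-(\lceil k/r\rceil-1)(\delta-1)$; it is $d$-optimal if equality holds. An $(r,\delta)$-LRC code is $r$-optimal if it is not an $(r',\delta)$-LRC code for any $1\le r'<r$. "Optimal $(r,\delta)$-LRC code" means an $(r,\delta)$-LRC code that is both $d$-optimal and $r$-optimal, with $d\ge\delta>2$ and $k>r\ge1$. *)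

theory Defs
  imports "HOL-Analysis.Cartesian_Space"
begin

text \<open>
  Codes of length \<open>n = CARD('n)\<close> over the finite field \<open>'a\<close> are sets of vectors in
  \<open>'a ^ 'n\<close>; the coordinate set \<open>[n]\<close> is the index type \<open>'n\<close>.
\<close>

definition hamming_dist :: "'a ^ 'n \<Rightarrow> 'a ^ 'n \<Rightarrow> nat" where
  "hamming_dist x y = card {i. x $ i \<noteq> y $ i}"

text \<open>\<open>Inf {} = 0\<close> on \<open>nat\<close>, so the value is meaningful only for codes with at least two words.\<close>

definition min_distance :: "('a ^ 'n) set \<Rightarrow> nat" where
  "min_distance C = Inf {hamming_dist x y | x y. x \<in> C \<and> y \<in> C \<and> x \<noteq> y}"

definition linear_code :: "nat \<Rightarrow> nat \<Rightarrow> nat \<Rightarrow> ('a :: field ^ 'n) set \<Rightarrow> bool" where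
  "linear_code n k d C \<longleftrightarrow>
     CARD('n) = n \<and> vec.subspace C \<and> vec.dim C = k \<and> min_distance C = d"

text \<open>
  Words of the punctured code are functions on \<open>R\<close>, that is, \<open>undefined\<close> outside \<open>R\<close>.
\<close>

definition puncture :: "('a ^ 'n) set \<Rightarrow> 'n set \<Rightarrow> ('n \<Rightarrow> 'a) set" where
  "puncture C R = (\<lambda>c. restrict (\<lambda>i. c $ i) R) ` C"

definition weight_on :: "'n set \<Rightarrow> ('n \<Rightarrow> 'a :: zero) \<Rightarrow> nat" where
  "weight_on R x = card {i \<in> R. x i \<noteq> 0}"

text \<open>Vacuously true if \<open>D\<close> is the zero code.\<close>

definition min_distance_on_ge :: "'n set \<Rightarrow> ('n \<Rightarrow> 'a :: zero) set \<Rightarrow> nat \<Rightarrow> bool" where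
  "min_distance_on_ge R D \<delta> \<longleftrightarrow> (\<forall>x\<in>D. x \<noteq> restrict (\<lambda>_. 0) R \<longrightarrow> weight_on R x \<ge> \<delta>)"

definition lrc_code :: "nat \<Rightarrow> nat \<Rightarrow> ('a :: field ^ 'n) set \<Rightarrow> bool" where
  "lrc_code r \<delta> C \<longleftrightarrow> vec.subspace C \<and>
     (\<forall>i. \<exists>R. i \<in> R \<and> card R \<le> r + \<delta> - 1 \<and> min_distance_on_ge R (puncture C R) \<delta>)"

text \<open>Equality in the Singleton-type bound; stated in \<open>int\<close> to avoid truncated subtraction.\<close>

definition d_optimal :: "nat \<Rightarrow> nat \<Rightarrow> nat \<Rightarrow> nat \<Rightarrow> nat \<Rightarrow> bool" where
  "d_optimal n k d r \<delta> \<longleftrightarrow>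
     int d = int n - int k + 1 - (\<lceil>real k / real r\<rceil> - 1) * (int \<delta> - 1)"

definition r_optimal :: "nat \<Rightarrow> nat \<Rightarrow> ('a :: field ^ 'n) set \<Rightarrow> bool" where
  "r_optimal r \<delta> C \<longleftrightarrow> (\<forall>r'. 1 \<le> r' \<and> r' < r \<longrightarrow> \<not> lrc_code r' \<delta> C)"

definition optimal_lrc_code ::
    "nat \<Rightarrow> nat \<Rightarrow> nat \<Rightarrow> nat \<Rightarrow> nat \<Rightarrow> ('a :: field ^ 'n) set \<Rightarrow> bool" where
  "optimal_lrc_code n k d r \<delta> C \<longleftrightarrow>
     linear_code n k d C \<and> lrc_code r \<delta> C \<and> d_optimal n k d r \<delta> \<and> r_optimal r \<delta> C \<and>
     d \<ge> \<delta> \<and> \<delta> > 2 \<and> k > r \<and> r \<ge> 1"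

end

theory Submission
  imports Defs
begin

text \<open>
  Optimality gives \<open>n = 5l\<close> and \<open>k = 3l - 5\<close> by arithmetic; the point is \<open>l \<le> 9\<close>. Since \<open>n - d\<close> coordinates
  already have to carry rank at least \<open>k - 1\<close>, repair groups can hardly overlap: for large \<open>l\<close> they
  partition the coordinates into 5-sets on which the code is a \<open>[5,3,3]\<close> MDS code. The words satisfying
  all local checks then contain \<open>C\<close> with index at most \<open>4^5\<close>, so a set of such words with pairwise
  distances at most 9 has at most \<open>4^5\<close> elements. Multiples of a weight-3 word in one group plus one
  weight-3 word from any other group form such a set of size \<open>4 * 30 * (l - 1)\<close>.
\<close>

section \<open>Shortened codes\<close>

text \<open>Coordinates are kept, so all shortened codes live in one vector space. The dimension
  equals \<open>vec.dim C\<close> minus the rank of \<open>C\<close> on \<open>S\<close>, so it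
  serves as a corank throughout.\<close>

definition shortened :: "('a::zero ^ 'n) set \<Rightarrow> 'n set \<Rightarrow> ('a ^ 'n) set" where
  "shortened C S = {c \<in> C. \<forall>i\<in>S. c $ i = 0}"

lemma shortened_subspace:
  fixes C :: "('a::field ^ 'n) set"
  assumes "vec.subspace C"
  shows "vec.subspace (shortened C S)"
  using assms unfolding vec.subspace_def shortened_def by simp

lemma dim_shortened_antimono:
  fixes C :: "('a::field ^ 'n) set"
  assumes "S \<subseteq> T"
  shows "vec.dim (shortened C T) \<le> vec.dim (shortened C S)"
  by (rule vec.dim_subset) (use assms in \<open>auto simp: shortened_def\<close>)

text \<open>Vanishing at \<open>i\<close> is a single linear condition: one word nonzero at
  \<open>i\<close> clears that coordinate in all others.\<close>

lemma dim_shortened_insert: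
  fixes C :: "('a::field ^ 'n) set"
  assumes C: "vec.subspace C"
  shows "vec.dim (shortened C S) \<le> vec.dim (shortened C (insert i S)) + 1"
proof (cases "\<exists>c \<in> shortened C S. c $ i \<noteq> 0")
  case False
  then have "shortened C (insert i S) = shortened C S"
    by (auto simp: shortened_def)
  then show ?thesis by simp
next
  case True
  then obtain c where c: "c \<in> shortened C S" "c $ i \<noteq> 0" by blast
  have "shortened C S \<subseteq> vec.span (insert c (shortened C (insert i S)))"
  proof
    fix x assume x: "x \<in> shortened C S"
    let ?y = "x - (x $ i / c $ i) *s c"
    have "?y \<in> shortened C S"
      using shortened_subspace[OF C] x c by (intro vec.subspace_diff vec.subspace_scale)
    then have "?y \<in> shortened C (insert i S)"
      using c by (auto simp: shortened_def)
    then have "?y + (x $ i / c $ i) *s c \<in> vec.span (insert c (shortened C (insert i S)))"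
      by (intro vec.span_add vec.span_scale vec.span_base) auto
    then show "x \<in> vec.span (insert c (shortened C (insert i S)))" by simp
  qed
  then have "vec.dim (shortened C S) \<le> vec.dim (insert c (shortened C (insert i S)))"
    by (rule vec.dim_mono)
  then show ?thesis by (auto simp: vec.dim_insert split: if_splits)
qed

lemma dim_shortened_insert_strict:
  fixes C :: "('a::field ^ 'n) set"
  assumes C: "vec.subspace C" and c: "c \<in> shortened C S" "c $ i \<noteq> 0"
  shows "vec.dim (shortened C (insert i S)) < vec.dim (shortened C S)"
proof -
  have "c \<notin> shortened C (insert i S)" using c by (auto simp: shortened_def)
  moreover have "shortened C (insert i S) \<subseteq> shortened C S" by (auto simp: shortened_def)
  ultimately show ?thesis
    using vec.subspace_dim_equal[OF shortened_subspace[OF C] shortened_subspace[OF C]] c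
    by (metis not_le)
qed

lemma dim_shortened_Un:
  fixes C :: "('a::field ^ 'n) set"
  assumes C: "vec.subspace C" and "finite X"
  shows "vec.dim (shortened C S) \<le> vec.dim (shortened C (S \<union> X)) + card X"
  using \<open>finite X\<close>
proof (induction X rule: finite_induct)
  case (insert x X)
  then show ?case
    using dim_shortened_insert[OF C, of "S \<union> X" x] by simp
qed simp

lemma dim_pos_obtains_nonzero:
  fixes V :: "('a::field ^ 'n) set"
  assumes "0 < vec.dim V"
  obtains c i where "c \<in> V" "c $ i \<noteq> 0"
proof -
  have "\<not> V \<subseteq> {0}" using assms vec.dim_eq_0[of V] by linarith
  then obtain c where "c \<in> V" "c \<noteq> 0" by blast
  then show ?thesis using that by (auto simp: vec_eq_iff)
qed

text \<open>Coefficient families over a basis give distinct vectors of \<open>V\<close>.\<close>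

lemma card_subspace_ge:
  fixes V :: "('a::{field,finite} ^ 'n) set"
  assumes V: "vec.subspace V"
  shows "CARD('a) ^ vec.dim V \<le> card V"
proof -
  obtain B where B: "B \<subseteq> V" "vec.independent B" "V \<subseteq> vec.span B" "card B = vec.dim V"
    using vec.basis_exists by blast
  let ?f = "\<lambda>u. \<Sum>v\<in>B. u v *s v"
  have "inj_on ?f (B \<rightarrow>\<^sub>E UNIV)"
  proof (rule inj_onI)
    fix u w assume u: "u \<in> B \<rightarrow>\<^sub>E UNIV" and w: "w \<in> B \<rightarrow>\<^sub>E UNIV" and eq: "?f u = ?f w"
    have "(\<Sum>v\<in>B. (u v - w v) *s v) = 0"
      using eq by (simp add: vec.scale_left_diff_distrib sum_subtractf)
    then have "u v - w v = 0" if "v \<in> B" for v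
      using vec.independentD[OF B(2) vec.finiteI_independent[OF B(2)] order_refl, of "\<lambda>v. u v - w v"] that
      by simp
    then show "u = w" by (intro PiE_ext[OF u w]) simp
  qed
  moreover have "?f ` (B \<rightarrow>\<^sub>E UNIV) \<subseteq> V"
    using V B(1) by (auto intro!: vec.subspace_sum vec.subspace_scale)
  ultimately have "card (B \<rightarrow>\<^sub>E (UNIV :: 'a set)) \<le> card V"
    by (intro card_inj_on_le) auto
  then show ?thesis by (simp add: card_PiE B(4))
qed

lemma min_distance_le_weight:
  fixes C :: "('a::field ^ 'n) set"
  assumes "vec.subspace C" "c \<in> C" "c \<noteq> 0"
  shows "min_distance C \<le> card {i. c $ i \<noteq> 0}"
proof -
  have "hamming_dist c 0 \<in> {hamming_dist x y | x y. x \<in> C \<and> y \<in> C \<and> x \<noteq> y}"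
    using assms vec.subspace_0 by blast
  then have "min_distance C \<le> hamming_dist c 0"
    unfolding min_distance_def by (intro cInf_lower) auto
  then show ?thesis by (simp add: hamming_dist_def)
qed

lemma min_distance_on_ge_punctureD:
  fixes C :: "('a::field ^ 'n) set"
  assumes "min_distance_on_ge R (puncture C R) \<delta>" "c \<in> C" "j \<in> R" "c $ j \<noteq> 0"
  shows "\<delta> \<le> card {i \<in> R. c $ i \<noteq> 0}"
proof -
  have "restrict (\<lambda>i. c $ i) R \<noteq> restrict (\<lambda>_. 0) R"
    using assms(3,4) by (metis restrict_apply')
  then have "\<delta> \<le> weight_on R (restrict (\<lambda>i. c $ i) R)"
    using assms(1,2) unfolding min_distance_on_ge_def puncture_def by blast
  also have "{i \<in> R. restrict (\<lambda>i. c $ i) R i \<noteq> 0} = {i \<in> R. c $ i \<noteq> 0}" by auto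
  then have "weight_on R (restrict (\<lambda>i. c $ i) R) = card {i \<in> R. c $ i \<noteq> 0}"
    by (simp add: weight_on_def)
  finally show ?thesis .
qed

lemma card_add_Compl:
  fixes S :: "'b::finite set"
  shows "card (- S) + card S = CARD('b)"
  by (metis Compl_disjoint2 Compl_partition2 card_Un_disjoint finite)

section \<open>Repair groups\<close>

locale repair_groups =
  fixes C :: "('a::field ^ 'n) set" and R :: "'n \<Rightarrow> 'n set"
  assumes subspace_C: "vec.subspace C"
    and mem_R: "i \<in> R i"
    and card_R: "card (R i) \<le> 5"
    and local_weight: "\<lbrakk>c \<in> C; j \<in> R i; c $ j \<noteq> 0\<rbrakk> \<Longrightarrow> 3 \<le> card {j \<in> R i. c $ j \<noteq> 0}"
begin

abbreviation sdim :: "'n set \<Rightarrow> nat" where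
  "sdim S \<equiv> vec.dim (shortened C S)"

text \<open>
  If \<open>\<rho> S\<close> is the rank of the code on \<open>S\<close>, then \<open>excess S - 5 * dim C = 3 * card S - 5 * \<rho> S\<close>,
  which vanishes on a union of disjoint groups of size 5 and rank 3.
\<close>

definition excess :: "'n set \<Rightarrow> nat" where
  "excess S = 3 * card S + 5 * sdim S"

text \<open>Two erasures in a group can be repaired: a local word supported on at most two places is
  too light to be nonzero.\<close>

lemma zero_on_group:
  assumes "c \<in> C" "E \<subseteq> R i" "card E \<le> 2" "\<And>j. j \<in> R i - E \<Longrightarrow> c $ j = 0" "j \<in> R i"
  shows "c $ j = 0"
proof (rule ccontr)
  assume "c $ j \<noteq> 0"
  then have "3 \<le> card {j \<in> R i. c $ j \<noteq> 0}" using local_weight assms by blast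
  also have "\<dots> \<le> card E" using assms(4) by (intro card_mono) auto
  finally show False using assms(3) by simp
qed

text \<open>Up to two of the new coordinates come free: once the rest of the group vanishes, so does
  \<open>E\<close>. Hence the rank grows by at most \<open>card (R i - S) - card E\<close>.\<close>

lemma sdim_Un_group:
  assumes "card E \<le> 2" "E \<subseteq> R i - S"
  shows "sdim S + card E \<le> sdim (S \<union> R i) + card (R i - S)"
proof -
  have "shortened C (S \<union> (R i - S - E)) \<subseteq> shortened C (S \<union> R i)"
  proof
    fix c assume c: "c \<in> shortened C (S \<union> (R i - S - E))"
    then have "c $ j = 0" if "j \<in> R i" for j
      using zero_on_group[of c E i j] assms that by (auto simp: shortened_def)
    then show "c \<in> shortened C (S \<union> R i)" using c by (auto simp: shortened_def)
  qed
  then have "sdim (S \<union> (R i - S - E)) \<le> sdim (S \<union> R i)" by (rule vec.dim_subset)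
  moreover have "sdim S \<le> sdim (S \<union> (R i - S - E)) + card (R i - S - E)"
    by (rule dim_shortened_Un[OF subspace_C]) simp
  moreover have "card (R i - S - E) + card E = card (R i - S)"
    using card_Diff_subset[of E "R i - S"] card_mono[of "R i - S" E] assms by simp
  ultimately show ?thesis by linarith
qed

lemma sdim_Un_group_2:
  assumes "2 \<le> card (R i - S)"
  shows "sdim S + 2 \<le> sdim (S \<union> R i) + card (R i - S)"
proof -
  obtain E where E: "E \<subseteq> R i - S" "card E = 2" "finite E"
    by (rule obtain_subset_with_card_n[OF assms])
  then show ?thesis using sdim_Un_group[OF _ E(1)] by linarith
qed

lemma card_Un_group: "card (S \<union> R i) = card S + card (R i - S)"
  using card_Un_disjoint[of S "R i - S"] by simp

lemma card_group_diff: "card (R i - S) \<le> 5"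
  using card_R[of i] card_mono[of "R i" "R i - S"] by fastforce

text \<open>With g new coordinates, g from 2 to 5, the rank grows by at most g - 2, so the excess
  gains at least 3g - 5(g - 2) = 10 - 2g. For g = 1 the rank stays and the gain is 3. Only g = 0 and
  g = 5 allow a gain below 2.\<close>

lemma excess_Un_group: "excess S \<le> excess (S \<union> R i)"
  and excess_Un_group_partial:
    "\<lbrakk>card (R i - S) \<noteq> 0; card (R i - S) \<noteq> 5\<rbrakk> \<Longrightarrow> excess S + 2 \<le> excess (S \<union> R i)"
proof -
  have g: "card (R i - S) \<le> 5" by (rule card_group_diff)
  consider "card (R i - S) = 0" | "card (R i - S) = 1" | "2 \<le> card (R i - S)" by linarith
  then have "excess S \<le> excess (S \<union> R i) \<and>
    (card (R i - S) \<noteq> 0 \<longrightarrow> card (R i - S) \<noteq> 5 \<longrightarrow> excess S + 2 \<le> excess (S \<union> R i))"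
  proof cases
    case 1
    then have "S \<union> R i = S" by auto
    then show ?thesis using 1 by simp
  next
    case 2
    then show ?thesis
      using sdim_Un_group[of "R i - S" i S] by (simp add: excess_def card_Un_group)
  next
    case 3
    then show ?thesis
      using sdim_Un_group_2[OF 3] g by (simp add: excess_def card_Un_group)
  qed
  then show "excess S \<le> excess (S \<union> R i)"
    "\<lbrakk>card (R i - S) \<noteq> 0; card (R i - S) \<noteq> 5\<rbrakk> \<Longrightarrow> excess S + 2 \<le> excess (S \<union> R i)"
    by blast+
qed

lemma sdim_le_Un_group: "sdim S \<le> sdim (S \<union> R i) + 3"
proof (cases "2 \<le> card (R i - S)")
  case True
  then show ?thesis using sdim_Un_group_2[OF True] card_group_diff[of i S] by linarith
next
  case False
  then show ?thesis using sdim_Un_group[of "{}" i S] by simp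
qed

section \<open>Sets whose complement splits into full groups\<close>

definition clean :: "'n set \<Rightarrow> bool" where
  "clean S \<longleftrightarrow> (\<forall>i. i \<notin> S \<longrightarrow> card (R i) = 5 \<and> R i \<inter> S = {} \<and> sdim S = sdim (S \<union> R i) + 3
     \<and> (\<forall>j. j \<notin> S \<longrightarrow> R i = R j \<or> R i \<inter> R j = {}))"

text \<open>If adding one or two groups never gains 2, then each group of a point outside
  \<open>S\<close> is entirely new, of size 5 and rank 3 over \<open>S\<close>, and two such groups
  cannot overlap partially; that is cleanness. The 6 is the rank of two groups.\<close>

lemma not_clean_excess:
  assumes "\<not> clean S"
  obtains T where "sdim S \<le> sdim T + 6" "excess S + 2 \<le> excess T"
proof -
  have "\<exists>T. sdim S \<le> sdim T + 6 \<and> excess S + 2 \<le> excess T"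
  proof (rule ccontr)
    assume no: "\<nexists>T. sdim S \<le> sdim T + 6 \<and> excess S + 2 \<le> excess T"
    have full: "card (R i) = 5 \<and> R i \<inter> S = {} \<and> sdim S = sdim (S \<union> R i) + 3" if i: "i \<notin> S" for i
    proof -
      have ne: "\<not> excess S + 2 \<le> excess (S \<union> R i)"
      proof -
        have "sdim S \<le> sdim (S \<union> R i) + 6" using sdim_le_Un_group[of S i] by linarith
        then show ?thesis using no by blast
      qed
      have "card (R i - S) \<noteq> 0" using mem_R i by auto
      then have 5: "card (R i - S) = 5" using excess_Un_group_partial ne by blast
      then have "R i - S = R i"
        using card_R[of i] by (intro card_seteq) auto
      \<comment> \<open>With five new coordinates, a rank increase of at most 2 would gain at least
        15 - 10 = 5.\<close>
      moreover have "sdim S = sdim (S \<union> R i) + 3"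
        using sdim_Un_group_2[of i S] ne sdim_le_Un_group[of S i] 5
        by (simp add: excess_def card_Un_group)
      ultimately show ?thesis using 5 by auto
    qed
    have "R i = R j \<or> R i \<inter> R j = {}" if ij: "i \<notin> S" "j \<notin> S" for i j
    proof -
      let ?T = "S \<union> R i \<union> R j"
      have "sdim S \<le> sdim ?T + 6"
        using sdim_le_Un_group[of S i] sdim_le_Un_group[of "S \<union> R i" j] by simp
      then have "\<not> excess S + 2 \<le> excess ?T" using no by blast
      moreover have "excess S \<le> excess (S \<union> R i)" by (rule excess_Un_group)
      ultimately have "\<not> excess (S \<union> R i) + 2 \<le> excess ?T" by linarith
      then consider "card (R j - (S \<union> R i)) = 0" | "card (R j - (S \<union> R i)) = 5"
        using excess_Un_group_partial by blast
      then show ?thesis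
      proof cases
        case 1
        then have "R j \<subseteq> R i" using full[OF ij(2)] by auto
        then have "R j = R i" using full[OF ij(1)] full[OF ij(2)] by (intro card_seteq) auto
        then show ?thesis by simp
      next
        case 2
        then have "R j - (S \<union> R i) = R j"
          using card_R[of j] by (intro card_seteq) auto
        then show ?thesis by blast
      qed
    qed
    then have "clean S" using full unfolding clean_def by blast
    then show False using assms by simp
  qed
  then show ?thesis using that by blast
qed

text \<open>The groups of the points outside \<open>S\<close> partition \<open>- S\<close> into
  blocks of size 5.\<close>

lemma clean_dvd_card:
  assumes "clean S"
  shows "5 dvd card (- S)"
proof -
  have "\<Union> (R ` (- S)) = - S"
    using assms mem_R unfolding clean_def by fastforce
  moreover have "card (\<Union> (R ` (- S))) = sum card (R ` (- S))"
    using assms unfolding clean_def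
    by (intro card_Union_disjoint) (auto simp: pairwise_def disjnt_def)
  moreover have "sum card (R ` (- S)) = (\<Sum>G\<in>R ` (- S). 5)"
    using assms unfolding clean_def by (intro sum.cong) auto
  ultimately show ?thesis by simp
qed

end

section \<open>Bounds from the global minimum distance\<close>

locale optimal_repair_groups = repair_groups C R
  for C :: "('a::field ^ 'n) set" and R +
  fixes s :: nat
  assumes dim_C: "vec.dim C = 3 * s + 1"
    and length_C: "CARD('n) = 5 * s + 10"
    and weight_C: "\<lbrakk>c \<in> C; c \<noteq> 0\<rbrakk> \<Longrightarrow> 10 \<le> card {i. c $ i \<noteq> 0}"
begin

text \<open>A nonzero shortened word needs ten nonzero places, all outside \<open>S\<close>.\<close>

lemma card_le_of_sdim_pos:
  assumes "0 < sdim S"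
  shows "card S \<le> 5 * s"
proof -
  obtain c i where c: "c \<in> shortened C S" "c $ i \<noteq> 0"
    using dim_pos_obtains_nonzero[OF assms] .
  then have "10 \<le> card {i. c $ i \<noteq> 0}"
    using weight_C[of c] by (cases "c = 0") (auto simp: shortened_def)
  also have "\<dots> \<le> card (- S)"
    using c by (intro card_mono) (auto simp: shortened_def)
  also have "\<dots> = 5 * s + 10 - card S" using card_add_Compl[of S] length_C by simp
  finally show ?thesis by simp
qed

text \<open>Appending coordinates one by one reaches rank \<open>dim C - 1\<close>, where the minimum distance applies.\<close>

lemma card_add_sdim_le:
  assumes "0 < sdim S"
  shows "card S + sdim S \<le> 5 * s + 1"
  using assms
proof (induction "sdim S" arbitrary: S rule: less_induct)
  case less
  show ?case
  proof (cases "sdim S = 1")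
    case True
    then show ?thesis using card_le_of_sdim_pos[OF less.prems] by simp
  next
    case False
    obtain c i where c: "c \<in> shortened C S" "c $ i \<noteq> 0"
      using dim_pos_obtains_nonzero[OF less.prems] .
    have "i \<notin> S" using c by (auto simp: shortened_def)
    moreover have lt: "sdim (insert i S) < sdim S"
      by (rule dim_shortened_insert_strict[OF subspace_C c])
    moreover have "sdim S \<le> sdim (insert i S) + 1" by (rule dim_shortened_insert[OF subspace_C])
    ultimately show ?thesis using less.hyps[OF lt] False less.prems by simp
  qed
qed

text \<open>Adding groups never lowers the excess, so \<open>S\<close> may be enlarged until one
  more group would exhaust the rank. Then \<open>sdim S\<close> is at most 3.\<close>

lemma excess_le:
  assumes "0 < sdim S"
  shows "excess S \<le> 5 * (3 * s + 1) + 4"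
  using assms
proof (induction "sdim S" arbitrary: S rule: less_induct)
  case less
  obtain c i where c: "c \<in> shortened C S" "c $ i \<noteq> 0"
    using dim_pos_obtains_nonzero[OF less.prems] .
  have "sdim (S \<union> R i) \<le> sdim (insert i S)"
    using mem_R by (intro dim_shortened_antimono) auto
  also have "\<dots> < sdim S" by (rule dim_shortened_insert_strict[OF subspace_C c])
  finally have lt: "sdim (S \<union> R i) < sdim S" .
  show ?case
  proof (cases "sdim (S \<union> R i) = 0")
    case False
    then show ?thesis using less.hyps[OF lt] excess_Un_group[of S i] by linarith
  next
    case True
    then have "sdim S \<le> 3" using sdim_le_Un_group[of S i] by linarith
    \<comment> \<open>The excess is 3 (\<open>card S + sdim S\<close>) + 2 \<open>sdim S\<close>, at
      most 3(5s + 1) + 6 = 5(3s + 1) + 4.\<close>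
    then show ?thesis using card_add_sdim_le[OF less.prems] by (simp add: excess_def)
  qed
qed

lemma excess_empty: "excess {} = 5 * (3 * s + 1)"
  by (simp add: excess_def shortened_def dim_C)

text \<open>
  The excess of a clean set is a multiple of 5, but a set obtained from an unclean empty set exceeds
  \<open>excess {}\<close> by 2, 3 or 4. So it is again not clean, and after three steps the excess passes its bound.
\<close>

lemma clean_empty:
  assumes "6 \<le> s"
  shows "clean {}"
proof (rule ccontr)
  assume "\<not> clean {}"
  have step: "\<exists>T. sdim S \<le> sdim T + 6 \<and> excess S + 2 \<le> excess T"
    if S: "5 * (3 * s + 1) < excess S" "0 < sdim S" for S
  proof -
    have "\<not> clean S"
    proof
      assume "clean S"
      then have "5 dvd card (- S)" by (rule clean_dvd_card)
      moreover have "card (- S) + card S = 5 * s + 10"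
        using card_add_Compl[of S] length_C by simp
      ultimately have "5 dvd card S" by presburger
      then have "5 dvd excess S" by (simp add: excess_def)
      then show False using S excess_le[of S] by presburger
    qed
    then show ?thesis using not_clean_excess by blast
  qed
  have 0: "sdim {} = 3 * s + 1" by (simp add: shortened_def dim_C)
  obtain S1 where S1: "sdim {} \<le> sdim S1 + 6" "excess {} + 2 \<le> excess S1"
    using not_clean_excess[OF \<open>\<not> clean {}\<close>] .
  moreover obtain S2 where "sdim S1 \<le> sdim S2 + 6" "excess S1 + 2 \<le> excess S2"
    using step[of S1] S1 0 excess_empty assms by auto
  moreover obtain S3 where "sdim S2 \<le> sdim S3 + 6" "excess S2 + 2 \<le> excess S3"
    using step[of S2] calculation 0 excess_empty assms by auto
  \<comment> \<open>Three steps cost at most 18 of the initial 3s + 1, which is at least 19 for s at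
    least 6. The total gain of 6 exceeds the allowed 4.\<close>
  moreover have "0 < sdim S3" using calculation 0 assms by linarith
  ultimately show False using excess_le[of S3] excess_empty by simp
qed

end

section \<open>Locally valid words\<close>

locale partitioned_repair_groups = optimal_repair_groups C R s
  for C :: "('a::{field,finite} ^ 'n) set" and R s +
  assumes clean: "clean {}"
begin

text \<open>Since the groups partition the coordinates, this is the direct sum of the local codes.
  It is the ambient space in which cosets of \<open>C\<close> are counted.\<close>

definition locally_valid :: "('a ^ 'n) set" where
  "locally_valid = {x. \<forall>i. \<exists>c\<in>C. \<forall>j\<in>R i. x $ j = c $ j}"

lemma subspace_locally_valid: "vec.subspace locally_valid"
proof (rule vec.subspaceI)
  show "0 \<in> locally_valid"
    using vec.subspace_0[OF subspace_C] unfolding locally_valid_def by blast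
next
  fix x y assume xy: "x \<in> locally_valid" "y \<in> locally_valid"
  show "x + y \<in> locally_valid"
    unfolding locally_valid_def mem_Collect_eq
  proof
    fix i
    from xy obtain a b where "a \<in> C" "\<forall>j\<in>R i. x $ j = a $ j" "b \<in> C" "\<forall>j\<in>R i. y $ j = b $ j"
      unfolding locally_valid_def by blast
    then show "\<exists>c\<in>C. \<forall>j\<in>R i. (x + y) $ j = c $ j"
      using vec.subspace_add[OF subspace_C] by (intro bexI[of _ "a + b"]) auto
  qed
next
  fix u x assume x: "x \<in> locally_valid"
  show "u *s x \<in> locally_valid"
    unfolding locally_valid_def mem_Collect_eq
  proof
    fix i
    from x obtain a where "a \<in> C" "\<forall>j\<in>R i. x $ j = a $ j"
      unfolding locally_valid_def by blast
    then show "\<exists>c\<in>C. \<forall>j\<in>R i. (u *s x) $ j = c $ j"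
      using vec.subspace_scale[OF subspace_C] by (intro bexI[of _ "u *s a"]) auto
  qed
qed

lemma code_subset_locally_valid: "C \<subseteq> locally_valid"
  by (auto simp: locally_valid_def)

lemma
  shows card_group: "card (R i) = 5"
    and sdim_group: "sdim (R i) + 3 = 3 * s + 1"
    and groups_eq_or_disjoint: "R i = R j \<or> R i \<inter> R j = {}"
proof -
  have "sdim {} = 3 * s + 1" by (simp add: shortened_def dim_C)
  then show "card (R i) = 5" "sdim (R i) + 3 = 3 * s + 1" "R i = R j \<or> R i \<inter> R j = {}"
    using clean[unfolded clean_def, rule_format, of i] by auto
qed

lemma card_groups: "card (range R) = s + 2"
proof -
  have "card (\<Union> (range R)) = sum card (range R)"
    using groups_eq_or_disjoint
    by (intro card_Union_disjoint) (auto simp: pairwise_def disjnt_def)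
  moreover have "\<Union> (range R) = UNIV" using mem_R by auto
  moreover have "sum card (range R) = (\<Sum>G\<in>range R. 5)"
    using card_group by (intro sum.cong) auto
  ultimately show ?thesis using length_C by simp
qed

text \<open>A locally valid word is determined by three coordinates in each group.\<close>

lemma card_locally_valid_le: "card locally_valid \<le> CARD('a) ^ (3 * (s + 2))"
proof -
  have "\<exists>I. I \<subseteq> G \<and> card I = 3" if "G \<in> range R" for G
    using obtain_subset_with_card_n[of 3 G] that card_group by fastforce
  then obtain I where I: "\<And>G. G \<in> range R \<Longrightarrow> I G \<subseteq> G \<and> card (I G) = 3" by metis
  define J where "J = (\<Union>G\<in>range R. I G)"
  have "card J \<le> (\<Sum>G\<in>range R. card (I G))"
    unfolding J_def by (rule card_UN_le) simp
  also have "\<dots> = 3 * (s + 2)" using I card_groups by simp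
  finally have J: "card J \<le> 3 * (s + 2)" .
  have "inj_on (\<lambda>x. restrict (\<lambda>i. x $ i) J) locally_valid"
  proof (rule inj_onI)
    fix x y
    assume xy: "x \<in> locally_valid" "y \<in> locally_valid"
      and eq: "restrict (\<lambda>i. x $ i) J = restrict (\<lambda>i. y $ i) J"
    have "x $ i = y $ i" for i
    proof -
      have "x - y \<in> locally_valid" using vec.subspace_diff[OF subspace_locally_valid] xy .
      then obtain c where c: "c \<in> C" "\<forall>j\<in>R i. (x - y) $ j = c $ j"
        unfolding locally_valid_def by blast
      have IR: "I (R i) \<subseteq> R i" "card (I (R i)) = 3" using I by auto
      have "c $ i = 0"
      proof (rule zero_on_group[OF c(1), of "R i - I (R i)" i])
        show "card (R i - I (R i)) \<le> 2"
          using card_Diff_subset[of "I (R i)" "R i"] IR card_group by simp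
        fix j assume "j \<in> R i - (R i - I (R i))"
        then have "j \<in> J" "j \<in> R i" by (auto simp: J_def)
        then show "c $ j = 0" using eq c(2) by (metis restrict_apply' right_minus_eq vector_minus_component)
      qed (use mem_R in auto)
      then show "x $ i = y $ i" using c(2) mem_R[of i] by (metis right_minus_eq vector_minus_component)
    qed
    then show "x = y" by (simp add: vec_eq_iff)
  qed
  moreover have "(\<lambda>x. restrict (\<lambda>i. x $ i) J) ` locally_valid \<subseteq> J \<rightarrow>\<^sub>E UNIV" by auto
  ultimately have "card locally_valid \<le> card (J \<rightarrow>\<^sub>E (UNIV :: 'a set))"
    by (intro card_inj_on_le) (auto intro: finite_PiE)
  also have "\<dots> = CARD('a) ^ card J" by (simp add: card_PiE)
  also have "\<dots> \<le> CARD('a) ^ (3 * (s + 2))" using J by (intro power_increasing) auto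
  finally show ?thesis .
qed

text \<open>Vanishing on the two places of \<open>R i - T\<close> costs at most 2 dimensions, on all
  of \<open>R i\<close> exactly 3. So some codeword vanishes on \<open>R i - T\<close> but not on
  \<open>R i\<close>, and the local distance forces its support there to be all of
  \<open>T\<close>.\<close>

lemma ex_weight_three_word:
  assumes T: "T \<subseteq> R i" "card T = 3"
  shows "\<exists>w \<in> locally_valid. {j. w $ j \<noteq> 0} = T"
proof -
  have "card (R i - T) = 2" using card_Diff_subset[of T "R i"] T card_group by simp
  then have "sdim {} \<le> sdim (R i - T) + 2"
    using dim_shortened_Un[OF subspace_C, of "R i - T" "{}"] by simp
  then have "sdim (R i) < sdim (R i - T)"
    using sdim_group[of i] by (simp add: shortened_def dim_C)
  then have "\<not> shortened C (R i - T) \<subseteq> shortened C (R i)"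
    using vec.dim_subset not_le by metis
  then obtain c where c: "c \<in> C" "\<forall>j\<in>R i - T. c $ j = 0" "\<exists>j\<in>R i. c $ j \<noteq> 0"
    by (auto simp: shortened_def)
  \<comment> \<open>Cutting the codeword off outside its group stays locally valid because other
    groups are disjoint from it; there the zero codeword is the witness.\<close>
  define w where "w = (\<chi> j. if j \<in> R i then c $ j else 0)"
  have "3 \<le> card {j \<in> R i. c $ j \<noteq> 0}" using c local_weight by blast
  moreover have "{j \<in> R i. c $ j \<noteq> 0} \<subseteq> T" using c by auto
  ultimately have "{j \<in> R i. c $ j \<noteq> 0} = T" using T by (intro card_seteq) auto
  then have "{j. w $ j \<noteq> 0} = T" by (auto simp: w_def)
  moreover have "w \<in> locally_valid"
    unfolding locally_valid_def mem_Collect_eq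
  proof
    fix k
    show "\<exists>c\<in>C. \<forall>j\<in>R k. w $ j = c $ j"
    proof (cases "R i = R k")
      case True
      then show ?thesis using c(1) by (intro bexI[of _ c]) (auto simp: w_def)
    next
      case False
      then have "R i \<inter> R k = {}" using groups_eq_or_disjoint by blast
      then show ?thesis
        using vec.subspace_0[OF subspace_C] by (intro bexI[of _ 0]) (auto simp: w_def)
    qed
  qed
  ultimately show ?thesis by blast
qed

section \<open>The anticode of weight-three words\<close>

definition triples :: "'n set \<Rightarrow> 'n set set" where
  "triples G0 = (\<Union>G\<in>range R - {G0}. {T. T \<subseteq> G \<and> card T = 3})"

text \<open>Each of the s + 1 other groups contributes 5 choose 3 triples, and disjoint groups share
  none.\<close>

lemma card_triples:
  assumes "G0 \<in> range R"
  shows "card (triples G0) = 10 * (s + 1)"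
proof -
  have "card (triples G0) = (\<Sum>G\<in>range R - {G0}. card {T. T \<subseteq> G \<and> card T = 3})"
    unfolding triples_def
  proof (rule card_UN_disjoint)
    show "\<forall>G\<in>range R - {G0}. \<forall>H\<in>range R - {G0}. G \<noteq> H \<longrightarrow>
      {T. T \<subseteq> G \<and> card T = 3} \<inter> {T. T \<subseteq> H \<and> card T = 3} = {}"
    proof (intro ballI impI, rule ccontr)
      fix G H assume GH: "G \<in> range R - {G0}" "H \<in> range R - {G0}" "G \<noteq> H"
        "{T. T \<subseteq> G \<and> card T = 3} \<inter> {T. T \<subseteq> H \<and> card T = 3} \<noteq> {}"
      then obtain T where "T \<subseteq> G \<inter> H" "card T = 3" by auto
      moreover have "G \<inter> H = {}" using GH groups_eq_or_disjoint by blast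
      ultimately show False by auto
    qed
  qed auto
  also have "\<dots> = (\<Sum>G\<in>range R - {G0}. 10)"
  proof (rule sum.cong)
    fix G assume "G \<in> range R - {G0}"
    then have "card G = 5" using card_group by auto
    then show "card {T. T \<subseteq> G \<and> card T = 3} = 10"
      using n_subsets[of G 3] by (simp add: eval_nat_numeral)
  qed simp
  also have "\<dots> = 10 * (s + 1)" using card_groups assms by simp
  finally show ?thesis .
qed

text \<open>
  Fix a word \<open>w\<^sub>0\<close> of weight 3 in one group. The words \<open>a *s w\<^sub>0 + b *s w\<^sub>T\<close>, where \<open>w\<^sub>T\<close> has support
  \<open>T\<close> in another group, differ pairwise in at most 9 places, so they lie in distinct cosets of \<open>C\<close>.
\<close>

lemma anticode_bound:
  "CARD('a) * (CARD('a) - 1) * (10 * (s + 1)) * CARD('a) ^ (3 * s + 1) \<le> CARD('a) ^ (3 * (s + 2))"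
proof -
  fix i0 :: 'n
  define G0 where "G0 = R i0"
  obtain T0 where T0: "T0 \<subseteq> G0" "card T0 = 3"
    using obtain_subset_with_card_n[of 3 G0] card_group by (auto simp: G0_def)
  then obtain w0 where w0: "w0 \<in> locally_valid" "{j. w0 $ j \<noteq> 0} = T0"
    using ex_weight_three_word unfolding G0_def by blast
  have "\<exists>w \<in> locally_valid. {j. w $ j \<noteq> 0} = T" if "T \<in> triples G0" for T
    using that ex_weight_three_word by (auto simp: triples_def)
  then obtain w where w: "\<And>T. T \<in> triples G0 \<Longrightarrow> w T \<in> locally_valid"
      "\<And>T. T \<in> triples G0 \<Longrightarrow> {j. w T $ j \<noteq> 0} = T"
    by metis
  have T: "card T = 3" "T \<inter> G0 = {}" if mem: "T \<in> triples G0" for T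
  proof -
    obtain i where "R i \<noteq> R i0" "T \<subseteq> R i" "card T = 3"
      using mem unfolding triples_def G0_def by blast
    then show "card T = 3" "T \<inter> G0 = {}"
      using groups_eq_or_disjoint[of i i0] unfolding G0_def by blast+
  qed
  have w0_nz: "w0 $ j \<noteq> 0 \<longleftrightarrow> j \<in> T0" for j using w0 by auto
  have w_nz: "w T $ j \<noteq> 0 \<longleftrightarrow> j \<in> T" if "T \<in> triples G0" for T j using w(2)[OF that] by auto
  \<comment> \<open>The scalar \<open>a\<close> may be 0, but \<open>b\<close> may not, as the
    triple is to be recovered from the support.\<close>
  define X where "X = (UNIV :: 'a set) \<times> (UNIV - {0 :: 'a}) \<times> triples G0"
  define f where "f = (\<lambda>((a, b, T), c). a *s w0 + b *s w T + c)"
  have "inj_on f (X \<times> C)"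
  proof (rule inj_onI)
    fix p q assume p: "p \<in> X \<times> C" and q: "q \<in> X \<times> C" and eq: "f p = f q"
    obtain a b T c where p': "p = ((a, b, T), c)" by (metis surj_pair)
    obtain a' b' T' c' where q': "q = ((a', b', T'), c')" by (metis surj_pair)
    have T1: "T \<in> triples G0" "T' \<in> triples G0" "b \<noteq> 0" "b' \<noteq> 0" "c \<in> C" "c' \<in> C"
      using p q by (auto simp: X_def p' q')
    define x where "x = (a *s w0 + b *s w T) - (a' *s w0 + b' *s w T')"
    have "x = c' - c" using eq unfolding x_def f_def p' q' by (simp add: algebra_simps)
    then have xC: "x \<in> C" using vec.subspace_diff[OF subspace_C] T1 by blast
    have "{j. x $ j \<noteq> 0} \<subseteq> T0 \<union> T \<union> T'"
    proof
      fix j assume "j \<in> {j. x $ j \<noteq> 0}"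
      then show "j \<in> T0 \<union> T \<union> T'"
        using w0_nz[of j] w_nz[OF T1(1), of j] w_nz[OF T1(2), of j] by (auto simp: x_def)
    qed
    then have "card {j. x $ j \<noteq> 0} \<le> card (T0 \<union> T \<union> T')" by (intro card_mono) auto
    also have "\<dots> \<le> card T0 + card T + card T'"
      by (meson add_le_mono card_Un_le le_trans order_refl)
    also have "\<dots> = 9" using T0 T T1 by simp
    finally have x0: "x = 0" using weight_C[OF xC] by linarith
    then have xj: "a * w0 $ j + b * w T $ j = a' * w0 $ j + b' * w T' $ j" for j
      by (simp add: x_def vec_eq_iff)
    have disj: "j \<notin> T0" if "j \<in> T \<union> T'" for j using that T(2) T1 T0 by blast
    \<comment> \<open>Off \<open>T0\<close> only the second summands survive, so their supports
      agree. A place in \<open>T\<close> then yields \<open>b = b'\<close>, and a place in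
      \<open>T0\<close> yields \<open>a = a'\<close>.\<close>
    have "j \<in> T \<longleftrightarrow> j \<in> T'" for j
    proof (cases "j \<in> T0")
      case False
      then have "b * w T $ j = b' * w T' $ j" using xj[of j] w0_nz[of j] by simp
      then show ?thesis
        using T1(3,4) w_nz[OF T1(1), of j] w_nz[OF T1(2), of j] by (metis mult_eq_0_iff)
    qed (use disj in auto)
    then have TT: "T = T'" by auto
    obtain j where j: "j \<in> T" using T(1)[OF T1(1)] by (metis card.empty ex_in_conv zero_neq_numeral)
    then have "w0 $ j = 0" "w T $ j \<noteq> 0" using disj w0_nz w_nz T1 by auto
    then have bb: "b = b'" using xj[of j] TT by simp
    obtain j0 where "j0 \<in> T0" using T0(2) by (metis card.empty ex_in_conv zero_neq_numeral)
    then have "w0 $ j0 \<noteq> 0" using w0_nz by auto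
    then have "a = a'" using xj[of j0] TT bb by simp
    moreover have "c = c'" using \<open>x = c' - c\<close> x0 by simp
    ultimately show "p = q" using TT bb by (simp add: p' q')
  qed
  moreover have "f ` (X \<times> C) \<subseteq> locally_valid"
    using w0(1) w(1) code_subset_locally_valid
    by (auto simp: f_def X_def intro!: vec.subspace_add[OF subspace_locally_valid]
        vec.subspace_scale[OF subspace_locally_valid])
  ultimately have le: "card (X \<times> C) \<le> card locally_valid" by (intro card_inj_on_le) auto
  have "card X = CARD('a) * (CARD('a) - 1) * (10 * (s + 1))"
    using card_triples[of G0] by (simp add: X_def card_cartesian_product card_Diff_subset G0_def)
  moreover have "CARD('a) ^ (3 * s + 1) \<le> card C"
    using card_subspace_ge[OF subspace_C] by (simp add: dim_C)
  ultimately have "CARD('a) * (CARD('a) - 1) * (10 * (s + 1)) * CARD('a) ^ (3 * s + 1) \<le> card (X \<times> C)"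
    unfolding card_cartesian_product by (metis mult_le_mono2)
  also have "\<dots> \<le> card locally_valid" by (rule le)
  also note card_locally_valid_le
  finally show ?thesis .
qed

end

section \<open>Parameters and the final count\<close>

theorem mainTheorem6:
  fixes C :: "('a :: {field, finite} ^ 'n) set"
    and n k d r \<delta> :: nat and s :: int
  assumes "CARD('a) = 4"
    and "optimal_lrc_code n k d r \<delta> C"
    and "r = 3" and "\<delta> = 3" and "d = 10"
    and "s \<ge> 2" and "int k = 3 * s + 1"
  shows "\<exists>l::int. 4 \<le> l \<and> l \<le> 9 \<and> int n = 5 * l \<and> int k = 3 * l - 5"
proof -
  define m where "m = nat s"
  have m: "s = int m" "k = 3 * m + 1" using assms(6,7) by (auto simp: m_def)
  have C: "CARD('n) = n" "vec.subspace C" "vec.dim C = k" "min_distance C = 10"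
    using assms by (auto simp: optimal_lrc_code_def linear_code_def)
  \<comment> \<open>Here k / r = m + 1/3, so equality in the Singleton-type bound reads 10 = n - (3m
    + 1) + 1 - 2m.\<close>
  have "\<lceil>real k / real r\<rceil> = int m + 1"
    using m assms(3) by (intro ceiling_unique) (auto simp: field_simps)
  then have n: "n = 5 * m + 10"
    using assms m by (auto simp: optimal_lrc_code_def d_optimal_def)
  have "\<forall>i. \<exists>R. i \<in> R \<and> card R \<le> 5 \<and> min_distance_on_ge R (puncture C R) 3"
    using assms(2-4) by (simp add: optimal_lrc_code_def lrc_code_def)
  then obtain R where R: "\<And>i. i \<in> R i" "\<And>i. card (R i) \<le> 5"
      "\<And>i. min_distance_on_ge (R i) (puncture C (R i)) 3"
    by metis
  interpret optimal_repair_groups C R m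
  proof
    show "3 \<le> card {j \<in> R i. c $ j \<noteq> 0}" if "c \<in> C" "j \<in> R i" "c $ j \<noteq> 0" for c i j
      using min_distance_on_ge_punctureD R(3) that .
    show "10 \<le> card {i. c $ i \<noteq> 0}" if "c \<in> C" "c \<noteq> 0" for c
      using min_distance_le_weight[OF C(2) that] C(4) by simp
  qed (use C R n m in simp_all)
  have "m \<le> 7"
  proof (rule ccontr)
    assume "\<not> m \<le> 7"
    then interpret partitioned_repair_groups C R m
      using clean_empty by unfold_locales simp
    have "4 * 3 * (10 * (m + 1)) * 4 ^ (3 * m + 1) \<le> (4 :: nat) ^ (3 * (m + 2))"
      using anticode_bound assms(1) by simp
    also have "\<dots> = 4 ^ 5 * 4 ^ (3 * m + 1)" by (simp add: power_add algebra_simps)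
    \<comment> \<open>The bound 120(m + 1) <= 1024 already fails at m = 8, where the left side is
      1080.\<close>
    finally have "4 * 3 * (10 * (m + 1)) \<le> (4 :: nat) ^ 5" by simp
    then show False using \<open>\<not> m \<le> 7\<close> by simp
  qed
  then show ?thesis
    \<comment> \<open>The witness is n / 5 = m + 2; m from 2 to 7 gives the range 4 to 9.\<close>
    using m n assms(6) by (intro exI[of _ "int m + 2"]) auto
qed

end
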